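(* Let $R$ be a ring and let $\Gamma'(R)$ be the unity product graph associated with $R$. If $R\cong B$ or $R\cong B\times B\times\cdots\times B$ (a Cartesian product of finitely many copies of $B$), where $B$ is a Boolean ring, then $\Gamma'(R)$ is trivial.
   Context: A Boolean ring is a ring with unity in which every element is idempotent. For a ring $R$ with unity $e$, let $U(R)$ denote the set of units of $R$. The unity product graph $\Gamma'(R)$ is the simple graph with vertex set $U(R)$ in which two distinct vertices $r_i,r_j$ are adjacent if and only if $r_i\cdot r_j=e$. A graph is trivial if it contains exactly one vertex. *)

theory Defs
  imports "HOL-Algebra.Chinese_Remainder" "Graph_Theory.Pair_Digraph"
begin

locale boolean_ring = ring R for R (structure) +
  assumes idem: "x \<in> carrier R \<Longrightarrow> x \<otimes> x = x"

text \<open>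
  A simple graph is represented by its vertex set together with its (symmetric, irreflexive)
  adjacency relation; every edge thus occurs once in each direction.
\<close>

definition unity_product_graph :: "('a, 'm) ring_scheme \<Rightarrow> 'a pair_pre_digraph" where
  "unity_product_graph R =
    \<lparr> pverts = Units R,
      parcs = {(r, s). r \<in> Units R \<and> s \<in> Units R \<and> r \<noteq> s \<and> r \<otimes>\<^bsub>R\<^esub> s = \<one>\<^bsub>R\<^esub>} \<rparr>"

definition trivial_graph :: "'a pair_pre_digraph \<Rightarrow> bool" where
  "trivial_graph G \<longleftrightarrow> card (pverts G) = 1"

text \<open>
  Symmetry needs no commutativity: \<open>r\<close> and \<open>s\<close> are units, so \<open>r s = e\<close> forces \<open>s r = e\<close>.
\<close>

lemma (in ring) unity_product_graph_simple:
  "pair_bidirected_digraph (unity_product_graph R)"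
proof
  fix e assume "e \<in> parcs (unity_product_graph R)"
  then show "fst e \<in> pverts (unity_product_graph R)" "snd e \<in> pverts (unity_product_graph R)"
    and "fst e \<noteq> snd e"
    by (auto simp: unity_product_graph_def)
next
  have "s \<otimes> r = \<one>" if "r \<in> Units R" "s \<in> Units R" "r \<otimes> s = \<one>" for r s
    using that Units_inv_comm by blast
  then show "symmetric (unity_product_graph R)"
    by (auto simp: unity_product_graph_def symmetric_def sym_def)
qed

end

theory Submission
  imports Defs
begin

text \<open>
  A unit \<open>u\<close> of a Boolean ring can be cancelled from \<open>u \<otimes> u = u\<close>, so \<open>\<one>\<close> is the only unit
  (\<open>boolean_ring.Units_eq_one\<close>). It therefore suffices that \<open>R\<close> itself is Boolean.
  This holds because idempotency is an equational law: isomorphisms transport it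
  (\<open>boolean_ring_iso\<close>), and it holds in a product as soon as it holds in each component
  (\<open>boolean_ring_RDirProd_list\<close>).
\<close>

lemma (in boolean_ring) Units_eq_one: "Units R = {\<one>}"
proof
  show "Units R \<subseteq> {\<one>}"
  proof
    fix u assume u: "u \<in> Units R"
    then have "u \<otimes> u = u \<otimes> \<one>"
      using idem by (simp add: Units_closed)
    then have "u = \<one>"
      using Units_l_cancel[OF u] u by (simp only: Units_closed one_closed)
    then show "u \<in> {\<one>}"
      by simp
  qed
qed simp

text \<open>
  The elements \<open>x \<otimes> x\<close> and \<open>x\<close> have the same image, because that image is idempotent, and
  an isomorphism is injective.
\<close>

lemma boolean_ring_iso:
  assumes "ring R" "boolean_ring S" "R \<simeq> S"
  shows "boolean_ring R"
proof -
  interpret R: ring R by fact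
  interpret S: boolean_ring S by fact
  obtain h where h: "h \<in> ring_iso R S"
    using assms(3) by (auto simp: is_ring_iso_def)
  have "x \<otimes>\<^bsub>R\<^esub> x = x" if x: "x \<in> carrier R" for x
  proof (rule inj_onD)
    show "inj_on h (carrier R)"
      using ring_iso_memE(5)[OF h] by (rule bij_betw_imp_inj_on)
    show "h (x \<otimes>\<^bsub>R\<^esub> x) = h x"
      using ring_iso_memE(1,2)[OF h] x S.idem by simp
  qed (use x in auto)
  then show ?thesis
    by unfold_locales
qed

lemma boolean_ring_RDirProd:
  assumes "boolean_ring R" "boolean_ring S"
  shows "boolean_ring (RDirProd R S)"
proof (intro boolean_ring.intro boolean_ring_axioms.intro)
  show "ring (RDirProd R S)"
    by (rule RDirProd_ring[OF assms[THEN boolean_ring.axioms(1)]])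
  show "x \<otimes>\<^bsub>RDirProd R S\<^esub> x = x" if "x \<in> carrier (RDirProd R S)" for x
    using that assms[THEN boolean_ring.idem]
    by (auto simp: RDirProd_def DirProd_def monoid.defs)
qed

lemma boolean_ring_RDirProd_list:
  assumes "\<And>B. B \<in> set Bs \<Longrightarrow> boolean_ring B"
  shows "boolean_ring (RDirProd_list Bs)"
  using assms
proof (induction Bs)
  case Nil
  \<comment> \<open>The empty product is the zero ring, which is Boolean.\<close>
  have "ring (RDirProd_list ([] :: ('a, 'b) ring_scheme list))"
    by (rule RDirProd_list_is_ring) simp
  then show ?case
    by (intro boolean_ring.intro boolean_ring_axioms.intro) (auto simp: monoid.defs)
next
  case (Cons B Bs)
  have "ring (RDirProd_list (B # Bs))"
    by (rule RDirProd_list_is_ring) (rule boolean_ring.axioms(1)[OF Cons.prems[OF nth_mem]])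
  moreover have "boolean_ring (RDirProd B (RDirProd_list Bs))"
    using Cons by (simp add: boolean_ring_RDirProd)
  moreover have "RDirProd_list (B # Bs) \<simeq> RDirProd B (RDirProd_list Bs)"
    using RDirProd_list_iso2[of B Bs] by (auto simp only: is_ring_iso_def)
  ultimately show ?case
    by (rule boolean_ring_iso)
qed

theorem theorem3p1:
  fixes R :: "('a, 'm) ring_scheme" and B :: "('b, 'k) ring_scheme"
  assumes "ring R"
    and "boolean_ring B"
    and "R \<simeq> B \<or> (\<exists>n\<ge>1. R \<simeq> RDirProd_list (replicate n B))"
  shows "trivial_graph (unity_product_graph R)"
proof -
  have "boolean_ring (RDirProd_list (replicate n B))" for n
    using assms(2) by (intro boolean_ring_RDirProd_list) simp
  then have "boolean_ring R"
    using assms by (auto intro: boolean_ring_iso)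
  then show ?thesis
    by (simp add: trivial_graph_def unity_product_graph_def boolean_ring.Units_eq_one)
qed

end
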